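(* Let $(X,d)$ be a complete metric space and let $(I(t))_{t\ge 0}$ be a family of operators $I(t)\colon X\to X$ with the following properties. (A1) $I(0)=\mathrm{id}_X$. (A2) There exist $x_0\in X$ and a function $\alpha\colon\mathbb{R}_+\times\mathbb{R}_+\to\mathbb{R}_+$, non-decreasing in the second argument, with $\alpha(\alpha(r,s),t)\le\alpha(r,s+t)$ for all $r,s,t\ge 0$, such that $I(t)$ maps $B(x_0,r)$ into $B(x_0,\alpha(r,t))$ for all $r,t\ge 0$. (A3) For every $r\ge 0$ there exists $\omega_r\ge 0$ such that $d(I(t)x,I(t)y)\le e^{t\omega_r}d(x,y)$ for all $t\in[0,1]$ and $x,y\in B(x_0,r)$; moreover $r\mapsto\omega_r$ is non-decreasing. (A4) There exists a countable set $\mathcal{D}\subset\mathcal{L}^I$ which is dense in $X$ and such that the sequence $(I(\pi_n^t)x)_{n\in\mathbb{N}}$ is relatively compact in $X$ for all $(x,t)\in\mathcal{D}\times\mathcal{T}$. Then there exists a family $(S(t))_{t\ge 0}$ of operators $S(t)\colon X\to X$ with the following properties. (i) There exists a subsequence $(n_l)_{l\in\mathbb{N}}\subset\mathbb{N}$ such that $S(t)x=\lim_{l\to\infty}I(\pi_{n_l}^t)x$ for all $(x,t)\in X\times\mathcal{T}$. (ii) $S(0)=\mathrm{id}_X$ and $S(s+t)=S(s)S(t)$ for all $s,t\ge 0$. (iii) For every $r,t\ge 0$: $d(x_0,S(t)x)\le\alpha(r,t)$ for all $x\in B(x_0,r)$, and $d(S(t)x,S(t)y)\le e^{t\omega_{\alpha(r,t)}}d(x,y)$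 for all $x,y\in B(x_0,r)$. (iv) The map $\mathbb{R}_+\to X$, $t\mapsto S(t)x$, is continuous for all $x\in X$. (v) For every $r\ge 0$ and $x\in B(x_0,r)\cap\mathcal{L}^I$ there exists $c\ge 0$ such that $d(S(s)x,S(t)x)\le c\,e^{T\omega_{\alpha(r,T)}}|s-t|$ for all $T\ge 0$ and $s,t\in[0,T]$.
   Context: $\mathbb{N}=\{1,2,\dots\}$, $\mathbb{N}_0=\mathbb{N}\cup\{0\}$, $\mathbb{R}_+=[0,\infty)$, and $B(x,r)=\{y\in X: d(x,y)\le r\}$ is the closed ball. $\mathcal{T}:=\{k2^{-n}: k,n\in\mathbb{N}_0\}$ is the set of dyadic numbers in $\mathbb{R}_+$. For $t\in\mathcal{T}$ and $n\in\mathbb{N}$ with $2^nt\in\mathbb{N}_0$, $I(\pi_n^t):=I(2^{-n})^{2^nt}$ is the $2^nt$-fold composition of $I(2^{-n})$ with itself (the identity if $t=0$). For fixed $t\in\mathcal{T}$ this is defined for all sufficiently large $n$, and sequences and limits in $n$ refer to those $n$. The Lipschitz set $\mathcal{L}^I$ of a family $(I(t))_{t\ge0}$ is the set of all $x\in X$ for which there exist $t_0>0$ and $c\ge 0$ with $d(I(t)x,x)\le ct$ for all $t\in[0,t_0]$. *)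

theory Defs
  imports "HOL-Analysis.Analysis"
begin

definition dyadic :: "real set" where
  "dyadic = {real k / 2 ^ n | k n. True}"

text \<open>
  The iterate \<open>I(\<pi>\<^sub>n\<^sup>t)\<close>, i.e. the \<open>2\<^sup>n t\<close>-fold composition of \<open>I(2\<^sup>-\<^sup>n)\<close>. It is meaningful
  only if \<open>2\<^sup>n t\<close> is a natural number, and then the floor has no effect. For a dyadic
  \<open>t\<close> this holds for all but finitely many \<open>n\<close>, so limits in \<open>n\<close> do not depend on the
  other values; statements about all terms of the sequence are to be restricted explicitly.
\<close>

definition iter :: "(real \<Rightarrow> 'a \<Rightarrow> 'a) \<Rightarrow> nat \<Rightarrow> real \<Rightarrow> 'a \<Rightarrow> 'a" where
  "iter I n t = (I (1 / 2 ^ n)) ^^ nat \<lfloor>2 ^ n * t\<rfloor>"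

definition lipschitz_set :: "(real \<Rightarrow> 'a::metric_space \<Rightarrow> 'a) \<Rightarrow> 'a set" where
  "lipschitz_set I = {x. \<exists>t0>0. \<exists>c\<ge>0. \<forall>t\<in>{0..t0}. dist (I t x) x \<le> c * t}"

end

theory Submission
  imports Defs "HOL-Library.Diagonal_Subsequence"
begin

text \<open>
  Write \<open>h = 2\<^sup>-\<^sup>n\<close> for the mesh width. The inequality for \<open>\<alpha>\<close> composes along the iteration, so
  all iterates of \<open>I h\<close> up to time \<open>t\<close> map the ball of radius \<open>r\<close> about \<open>x0\<close> into the one of radius
  \<open>\<alpha> r t\<close> (\<open>funpow_in_ball\<close>). On that ball the Lipschitz constants of the single steps multiply to
  at most \<open>exp (t * \<omega> (\<alpha> r t))\<close>, whatever \<open>h\<close> is (\<open>iter_lipschitz\<close>). For \<open>x\<close> in the Lipschitz set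
  a single step moves \<open>x\<close> by \<open>O(h)\<close>, and transporting this displacement along the orbit shows that
  the orbit of \<open>x\<close> is Lipschitz in time, again uniformly in \<open>h\<close>, up to an error of one mesh width
  (\<open>iter_time_lipschitz\<close>).

  A diagonal argument over the countable set of pairs of a point of the dense set and a dyadic time
  gives one subsequence along which the iterates of these points converge at these times
  (\<open>diagonal_subsequence_convergent\<close>). The two uniform estimates then carry convergence over from
  dyadic times to all real times and from the dense set to the whole space. The iterate is
  defined at every real time, by rounding down to the grid, so the
  semigroup is the limit of the iterates at all times alike, and their bounds pass to the limit.

  For the semigroup law at real times, rounding \<open>s\<close> and \<open>t\<close> separately costs at most two mesh widths
  compared with \<open>s + t\<close>. On the dense set this vanishes in the limit by Lipschitz continuity in
  time, and the law extends by continuity in space. Continuity in time of every orbit follows in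
  the same way, as nearby orbits stay uniformly close on bounded time intervals.
\<close>

section \<open>Approximation of convergent sequences\<close>

text \<open>This is how convergence is transferred by both density arguments: \<open>v\<close> is the sequence of
  iterates at a nearby dyadic time or at a nearby initial point.\<close>

lemma convergent_if_approximable:
  fixes u :: "nat \<Rightarrow> 'a::complete_space"
  assumes approx: "\<And>e. e > 0 \<Longrightarrow> \<exists>v. convergent v \<and> (\<forall>\<^sub>F n in sequentially. dist (u n) (v n) < e)"
  shows "convergent u"
proof -
  have "Cauchy u"
  proof (rule metric_CauchyI)
    fix e :: real assume "e > 0"
    then obtain v where "convergent v" and ev: "\<forall>\<^sub>F n in sequentially. dist (u n) (v n) < e/3"
      using approx[of "e/3"] by auto
    then have "Cauchy v" by (simp add: convergent_Cauchy)
    then obtain M1 where M1: "\<And>m n. m \<ge> M1 \<Longrightarrow> n \<ge> M1 \<Longrightarrow> dist (v m) (v n) < e/3"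
      using \<open>e > 0\<close> metric_CauchyD[of v "e/3"] by auto
    obtain M2 where M2: "\<And>n. n \<ge> M2 \<Longrightarrow> dist (u n) (v n) < e/3"
      using ev by (auto simp: eventually_sequentially)
    show "\<exists>M. \<forall>m\<ge>M. \<forall>n\<ge>M. dist (u m) (u n) < e"
    proof (intro exI[of _ "max M1 M2"] allI impI)
      fix m n assume "m \<ge> max M1 M2" "n \<ge> max M1 M2"
      then have "dist (v m) (v n) < e/3" "dist (u m) (v m) < e/3" "dist (u n) (v n) < e/3"
        using M1 M2 by auto
      then show "dist (u m) (u n) < e"
        using dist_triangle[of "u m" "u n" "v m"] dist_triangle[of "v m" "u n" "v n"]
          dist_commute[of "u n" "v n"] by linarith
    qed
  qed
  then show ?thesis by (rule Cauchy_convergent)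
qed

text \<open>Compactness is asked of a tail of each sequence, as the iterates at a dyadic time belong to a
  given compact set only from some mesh width on; passing to a subsequence absorbs the initial
  segment.\<close>

lemma diagonal_subsequence_convergent:
  fixes f :: "'i \<Rightarrow> nat \<Rightarrow> 'a::metric_space"
  assumes count: "countable J"
    and K: "\<And>i. i \<in> J \<Longrightarrow> \<exists>C. compact C \<and> (\<forall>\<^sub>F n in sequentially. f i n \<in> C)"
  obtains N :: "nat \<Rightarrow> nat" where "strict_mono N" "\<And>l. N l \<ge> 1"
    "\<And>i. i \<in> J \<Longrightarrow> convergent (\<lambda>l. f i (N l))"
proof (cases "J = {}")
  case True
  then show ?thesis using that[of Suc] by (simp add: strict_mono_Suc_iff)
next
  case False
  define e where "e = from_nat_into J"
  have eJ: "e k \<in> J" for k unfolding e_def using False by (rule from_nat_into)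
  interpret subseqs "\<lambda>k s. convergent (\<lambda>l. f (e k) (s l))"
  proof
    fix k and s :: "nat \<Rightarrow> nat" assume s: "strict_mono s"
    obtain C M where C: "compact C" "\<And>n. n \<ge> M \<Longrightarrow> f (e k) n \<in> C"
      using K[OF eJ[of k]] by (auto simp: eventually_sequentially)
    have "f (e k) (s (l + M)) \<in> C" for l
      using C(2) seq_suble[OF s, of "l + M"] by simp
    then obtain y r where r: "strict_mono r" "((\<lambda>l. f (e k) (s (l + M))) \<circ> r) \<longlonglongrightarrow> y"
      using C(1) unfolding compact_def by metis
    have "strict_mono (\<lambda>l. r l + M)" using r(1) by (auto simp: strict_mono_def)
    moreover have "convergent (\<lambda>l. f (e k) ((s \<circ> (\<lambda>l. r l + M)) l))"
      using r(2) by (auto simp: convergent_def o_def)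
    ultimately show "\<exists>r'. strict_mono r' \<and> convergent (\<lambda>l. f (e k) ((s \<circ> r') l))" by blast
  qed
  have diag: "convergent (\<lambda>l. f (e k) (diagseq (l + Suc k)))" for k
  proof -
    have "convergent (\<lambda>l. f (e k) ((diagseq \<circ> (+) (Suc k)) l))"
    proof (rule diagseq_holds)
      fix n and r s :: "nat \<Rightarrow> nat"
      assume "strict_mono r" "convergent (\<lambda>l. f (e n) (s l))"
      then show "convergent (\<lambda>l. f (e n) ((s \<circ> r) l))"
        using convergent_subseq_convergent[of "\<lambda>l. f (e n) (s l)" r] by (simp add: o_def)
    qed
    then show ?thesis by (simp add: o_def add.commute)
  qed
  have conv: "convergent (\<lambda>l. f (e k) (diagseq l))" for k
    using diag[of k] convergent_ignore_initial_segment[of "\<lambda>l. f (e k) (diagseq l)" "Suc k"] by simp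
  show ?thesis
  proof (rule that[of "\<lambda>l. diagseq (Suc l)"])
    show "strict_mono (\<lambda>l. diagseq (Suc l))"
      using subseq_diagseq by (simp add: strict_mono_def)
    show "diagseq (Suc l) \<ge> 1" for l
      using seq_suble[OF subseq_diagseq, of "Suc l"] by simp
    fix i assume "i \<in> J"
    then obtain k where "i = e k"
      unfolding e_def using from_nat_into_surj[OF count] by metis
    then show "convergent (\<lambda>l. f i (diagseq (Suc l)))"
      using conv[of k] convergent_ignore_initial_segment[of "\<lambda>l. f (e k) (diagseq l)" 1] by simp
  qed
qed

section \<open>Dyadic numbers and the time grid\<close>

lemma countable_dyadic: "countable dyadic"
proof -
  have "dyadic = (\<lambda>(k, n). real k / 2 ^ n) ` (UNIV :: (nat \<times> nat) set)"
    by (auto simp: dyadic_def)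
  then show ?thesis by (metis countable_image uncountable_def countableI_type)
qed

lemma dyadic_multiple_Nats:
  assumes "t \<in> dyadic"
  shows "\<forall>\<^sub>F n in sequentially. 2 ^ n * t \<in> \<nat>"
proof -
  obtain k m where t: "t = real k / 2 ^ m" using assms by (auto simp: dyadic_def)
  have "2 ^ n * t \<in> \<nat>" if "n \<ge> m" for n
  proof -
    have "2 ^ n * t = real (2 ^ (n - m) * k)"
      using that by (simp add: t power_add field_simps flip: power_add)
    then show ?thesis by (metis of_nat_in_Nats)
  qed
  then show ?thesis by (auto simp: eventually_sequentially)
qed

lemma grid_point:
  assumes "t \<ge> (0::real)"
  shows "real (nat \<lfloor>2 ^ n * t\<rfloor>) / 2 ^ n \<le> t" "t < real (nat \<lfloor>2 ^ n * t\<rfloor>) / 2 ^ n + 1 / 2 ^ n"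
proof -
  have "real (nat \<lfloor>2 ^ n * t\<rfloor>) = of_int \<lfloor>2 ^ n * t\<rfloor>" using assms by simp
  then have "real (nat \<lfloor>2 ^ n * t\<rfloor>) \<le> 2 ^ n * t" "2 ^ n * t < real (nat \<lfloor>2 ^ n * t\<rfloor>) + 1"
    by linarith+
  then show "real (nat \<lfloor>2 ^ n * t\<rfloor>) / 2 ^ n \<le> t" "t < real (nat \<lfloor>2 ^ n * t\<rfloor>) / 2 ^ n + 1 / 2 ^ n"
    by (simp_all add: field_simps)
qed

lemma dyadic_approx_below:
  assumes "t \<ge> (0::real)" "e > 0"
  obtains q where "q \<in> dyadic" "0 \<le> q" "q \<le> t" "\<bar>q - t\<bar> < e"
proof -
  obtain n where n: "(1/2::real) ^ n < e" using real_arch_pow_inv[of e "1/2"] assms by auto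
  define q where "q = real (nat \<lfloor>2 ^ n * t\<rfloor>) / 2 ^ n"
  have "q \<in> dyadic" unfolding q_def dyadic_def by blast
  moreover have "0 \<le> q" by (simp add: q_def)
  moreover have "q \<le> t" "\<bar>q - t\<bar> < e"
    using grid_point[OF assms(1), of n] n by (auto simp: q_def power_divide)
  ultimately show ?thesis using that by blast
qed

lemma iter_grid: "iter I n (real k / 2 ^ n) = I (1 / 2 ^ n) ^^ k"
  by (simp add: iter_def)

section \<open>Stability of the iterates\<close>

locale stable_family =
  fixes I :: "real \<Rightarrow> 'a::complete_space \<Rightarrow> 'a"
    and x0 :: 'a
    and \<alpha> :: "real \<Rightarrow> real \<Rightarrow> real"
    and \<omega> :: "real \<Rightarrow> real"
  assumes I_zero: "I 0 = id"
    and \<alpha>_nonneg: "\<lbrakk>r \<ge> 0; t \<ge> 0\<rbrakk> \<Longrightarrow> \<alpha> r t \<ge> 0"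
    and \<alpha>_mono: "\<lbrakk>r \<ge> 0; 0 \<le> s; s \<le> t\<rbrakk> \<Longrightarrow> \<alpha> r s \<le> \<alpha> r t"
    and \<alpha>_comp: "\<lbrakk>r \<ge> 0; s \<ge> 0; t \<ge> 0\<rbrakk> \<Longrightarrow> \<alpha> (\<alpha> r s) t \<le> \<alpha> r (s + t)"
    and I_ball: "\<lbrakk>r \<ge> 0; t \<ge> 0; x \<in> cball x0 r\<rbrakk> \<Longrightarrow> I t x \<in> cball x0 (\<alpha> r t)"
    and \<omega>_nonneg: "r \<ge> 0 \<Longrightarrow> \<omega> r \<ge> 0"
    and \<omega>_mono: "\<lbrakk>0 \<le> r; r \<le> r'\<rbrakk> \<Longrightarrow> \<omega> r \<le> \<omega> r'"
    and I_lip: "\<lbrakk>r \<ge> 0; 0 \<le> t; t \<le> 1; x \<in> cball x0 r; y \<in> cball x0 r\<rbrakk>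
                \<Longrightarrow> dist (I t x) (I t y) \<le> exp (t * \<omega> r) * dist x y"
begin

abbreviation growth :: "real \<Rightarrow> real \<Rightarrow> real" where
  "growth r t \<equiv> exp (t * \<omega> (\<alpha> r t))"

lemma growth_mono:
  assumes "r \<ge> 0" "0 \<le> s" "s \<le> t"
  shows "growth r s \<le> growth r t"
  using assms by (auto intro!: mult_mono \<omega>_mono \<alpha>_mono \<alpha>_nonneg \<omega>_nonneg)

text \<open>The inequality for \<open>\<alpha>\<close> composes along the iteration. The induction starts with the radius
  \<open>\<alpha> r 0\<close>, which may be smaller than \<open>r\<close>; but \<open>I 0\<close> is the identity and maps the ball of radius
  \<open>r\<close> into that of radius \<open>\<alpha> r 0\<close>, so a starting point
  in the former ball lies in the latter.\<close>

lemma funpow_in_ball: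
  assumes "r \<ge> 0" "h \<ge> 0" "x \<in> cball x0 r" "real k * h \<le> t"
  shows "(I h ^^ k) x \<in> cball x0 (\<alpha> r t)"
proof -
  have *: "(I h ^^ k) x \<in> cball x0 (\<alpha> r (real k * h))" for k
  proof (induction k)
    case 0
    then show ?case using I_ball[of r 0 x] I_zero assms by simp
  next
    case (Suc k)
    have "I h ((I h ^^ k) x) \<in> cball x0 (\<alpha> (\<alpha> r (real k * h)) h)"
      using I_ball[OF _ _ Suc] \<alpha>_nonneg assms by simp
    moreover have "\<alpha> (\<alpha> r (real k * h)) h \<le> \<alpha> r (real (Suc k) * h)"
      using \<alpha>_comp[of r "real k * h" h] assms by (simp add: algebra_simps)
    ultimately show ?case by auto
  qed
  have "\<alpha> r (real k * h) \<le> \<alpha> r t" using assms by (intro \<alpha>_mono) auto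
  then show ?thesis using *[of k] by auto
qed

lemma funpow_lipschitz_within:
  assumes "R \<ge> 0" "0 \<le> h" "h \<le> 1"
    and "\<And>j. j < k \<Longrightarrow> (I h ^^ j) x \<in> cball x0 R" "\<And>j. j < k \<Longrightarrow> (I h ^^ j) y \<in> cball x0 R"
  shows "dist ((I h ^^ k) x) ((I h ^^ k) y) \<le> exp (real k * h * \<omega> R) * dist x y"
  using assms(4,5)
proof (induction k)
  case (Suc k)
  have "dist ((I h ^^ Suc k) x) ((I h ^^ Suc k) y)
      \<le> exp (h * \<omega> R) * dist ((I h ^^ k) x) ((I h ^^ k) y)"
    using I_lip[OF assms(1-3)] Suc.prems by simp
  also have "\<dots> \<le> exp (h * \<omega> R) * (exp (real k * h * \<omega> R) * dist x y)"
    using Suc by (intro mult_left_mono Suc.IH) auto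
  also have "\<dots> = exp (real (Suc k) * h * \<omega> R) * dist x y"
    by (simp add: exp_add algebra_simps)
  finally show ?case .
qed simp

text \<open>One step moves \<open>x\<close> by at most \<open>c * h\<close>, and the iterates magnify this by at most the growth
  factor; the orbit of \<open>I h x\<close> is that of \<open>x\<close> one step ahead, so both stay in the ball of radius
  \<open>\<alpha> r T\<close>.\<close>

lemma funpow_step:
  assumes r: "r \<ge> 0" "x \<in> cball x0 r" and h: "0 \<le> h" "h \<le> 1"
    and step: "dist (I h x) x \<le> c * h" and T: "real (Suc k) * h \<le> T"
  shows "dist ((I h ^^ Suc k) x) ((I h ^^ k) x) \<le> c * growth r T * h"
proof -
  have T0: "0 \<le> T" using order_trans[OF _ T] h(1) by simp
  have "real j * h \<le> real (Suc k) * h" if "j \<le> Suc k" for j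
    using that h by (intro mult_right_mono) auto
  then have ball: "(I h ^^ j) x \<in> cball x0 (\<alpha> r T)" if "j \<le> Suc k" for j
    using funpow_in_ball[OF r(1) h(1) r(2)] that T by (meson order_trans)
  have shift: "(I h ^^ j) (I h x) = (I h ^^ Suc j) x" for j
    by (simp only: funpow_Suc_right o_apply)
  have "dist ((I h ^^ k) (I h x)) ((I h ^^ k) x)
      \<le> exp (real k * h * \<omega> (\<alpha> r T)) * dist (I h x) x"
    using \<alpha>_nonneg[OF r(1) T0] h ball
    by (intro funpow_lipschitz_within) (auto simp only: shift Suc_le_eq less_Suc_eq_le less_imp_le)
  also have "\<dots> \<le> growth r T * (c * h)"
  proof (intro mult_mono step)
    have "real k * h \<le> T" using T h by (simp add: algebra_simps)
    then show "exp (real k * h * \<omega> (\<alpha> r T)) \<le> growth r T"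
      using \<omega>_nonneg[OF \<alpha>_nonneg[OF r(1) T0]] by (simp add: mult_right_mono)
  qed auto
  finally show ?thesis unfolding shift by (simp add: mult_ac)
qed

lemma funpow_time_lipschitz:
  assumes r: "r \<ge> 0" "x \<in> cball x0 r" and h: "0 \<le> h" "h \<le> 1"
    and step: "dist (I h x) x \<le> c * h" and km: "k \<le> m" and T: "real m * h \<le> T"
  shows "dist ((I h ^^ m) x) ((I h ^^ k) x) \<le> c * growth r T * (real m * h - real k * h)"
  using km T
proof (induction m rule: dec_induct)
  case (step m)
  have "real m * h \<le> T" using step.prems h by (simp add: algebra_simps)
  moreover have "dist ((I h ^^ Suc m) x) ((I h ^^ m) x) \<le> c * growth r T * h"
    using funpow_step[OF r h] assms(5) step.prems by blast
  ultimately show ?case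
    using step.IH dist_triangle[of "(I h ^^ Suc m) x" "(I h ^^ k) x" "(I h ^^ m) x"]
    by (simp add: algebra_simps)
qed simp

lemma iter_in_ball:
  assumes "r \<ge> 0" "t \<ge> 0" "x \<in> cball x0 r"
  shows "iter I n t x \<in> cball x0 (\<alpha> r t)"
  unfolding iter_def using assms grid_point(1)[OF assms(2), of n]
  by (intro funpow_in_ball) auto

lemma iter_lipschitz:
  assumes "r \<ge> 0" "t \<ge> 0" "x \<in> cball x0 r" "y \<in> cball x0 r"
  shows "dist (iter I n t x) (iter I n t y) \<le> growth r t * dist x y"
proof -
  define k where "k = nat \<lfloor>2 ^ n * t\<rfloor>"
  define h :: real where "h = 1 / 2 ^ n"
  have h: "0 \<le> h" "h \<le> 1" by (simp_all add: h_def)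
  have kt: "real k * h \<le> t" using grid_point(1)[OF assms(2), of n] by (simp add: k_def h_def)
  have j: "real j * h \<le> t" if "j < k" for j
    using that h kt by (meson less_imp_le mult_right_mono of_nat_mono order_trans)
  have R: "\<alpha> r t \<ge> 0" using assms \<alpha>_nonneg by simp
  have "dist ((I h ^^ k) x) ((I h ^^ k) y) \<le> exp (real k * h * \<omega> (\<alpha> r t)) * dist x y"
    using h R j assms by (intro funpow_lipschitz_within funpow_in_ball) auto
  also have "\<dots> \<le> growth r t * dist x y"
    using kt \<omega>_nonneg[OF R] by (intro mult_right_mono) (auto intro: mult_right_mono)
  finally show ?thesis by (simp add: iter_def k_def h_def)
qed

text \<open>The constant \<open>c\<close> is chosen before \<open>r\<close> and \<open>T\<close>, as the final estimate for the semigroup has to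
  hold with one constant for all time horizons; which \<open>n\<close> are large enough depends on \<open>x\<close> only.\<close>

definition drift_bound :: "real \<Rightarrow> 'a \<Rightarrow> nat \<Rightarrow> bool" where
  "drift_bound c x n \<longleftrightarrow> (\<forall>r\<ge>0. \<forall>T s t. x \<in> cball x0 r \<longrightarrow> s \<in> {0..T} \<longrightarrow> t \<in> {0..T} \<longrightarrow>
    dist (iter I n s x) (iter I n t x) \<le> c * growth r T * (\<bar>s - t\<bar> + 1 / 2 ^ n))"

lemma drift_boundD:
  "\<lbrakk>drift_bound c x n; r \<ge> 0; x \<in> cball x0 r; s \<in> {0..T}; t \<in> {0..T}\<rbrakk>
    \<Longrightarrow> dist (iter I n s x) (iter I n t x) \<le> c * growth r T * (\<bar>s - t\<bar> + 1 / 2 ^ n)"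
  by (simp add: drift_bound_def)

text \<open>Rounding \<open>s\<close> and \<open>t\<close> down to the grid changes their distance by less than one mesh width,
  which is the additional term in the bound. The mesh width has to be below the time up to which the
  Lipschitz condition on \<open>I\<close> holds at \<open>x\<close>.\<close>

lemma iter_time_lipschitz:
  assumes "x \<in> lipschitz_set I"
  obtains c where "c \<ge> 0" "\<forall>\<^sub>F n in sequentially. drift_bound c x n"
proof -
  obtain t0 c where t0: "t0 > 0" and c: "c \<ge> 0" "\<And>t. t \<in> {0..t0} \<Longrightarrow> dist (I t x) x \<le> c * t"
    using assms by (auto simp: lipschitz_set_def)
  have "(\<lambda>n. 1 / 2 ^ n :: real) \<longlonglongrightarrow> 0"
    using LIMSEQ_realpow_zero[of "1/2"] by (simp add: power_divide)
  then have small: "\<forall>\<^sub>F n in sequentially. (1 / 2 ^ n :: real) < t0"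
    using t0 by (rule order_tendstoD)
  have bound: "dist (iter I n s x) (iter I n t x) \<le> c * growth r T * (\<bar>s - t\<bar> + 1 / 2 ^ n)"
    if n: "(1 / 2 ^ n :: real) < t0" and r: "r \<ge> 0" "x \<in> cball x0 r"
      and st: "0 \<le> s" "s \<le> t" "t \<le> T" for n r s t T
  proof -
    define h :: real where "h = 1 / 2 ^ n"
    define k where "k = nat \<lfloor>2 ^ n * s\<rfloor>"
    define m where "m = nat \<lfloor>2 ^ n * t\<rfloor>"
    have h: "0 \<le> h" "h \<le> 1" "h \<le> t0" using n by (simp_all add: h_def)
    have km: "k \<le> m" unfolding k_def m_def using st by (intro nat_mono floor_mono) simp
    have grid: "s < real k * h + h" "real m * h \<le> t"
      using grid_point(2)[OF st(1), of n] grid_point(1)[of t n] st by (simp_all add: k_def m_def h_def)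
    have "dist ((I h ^^ m) x) ((I h ^^ k) x) \<le> c * growth r T * (real m * h - real k * h)"
      using funpow_time_lipschitz[OF r h(1,2) c(2) km] h grid st by simp
    also have "\<dots> \<le> c * growth r T * (\<bar>s - t\<bar> + h)"
      using grid c(1) st by (intro mult_left_mono) auto
    finally show ?thesis by (simp add: iter_def k_def m_def h_def dist_commute)
  qed
  have "\<forall>\<^sub>F n in sequentially. drift_bound c x n"
    using small
  proof eventually_elim
    case (elim n)
    show ?case unfolding drift_bound_def
    proof (intro allI impI)
      fix r T s t :: real
      assume "0 \<le> r" "x \<in> cball x0 r" "s \<in> {0..T}" "t \<in> {0..T}"
      then show "dist (iter I n s x) (iter I n t x) \<le> c * growth r T * (\<bar>s - t\<bar> + 1 / 2 ^ n)"
        using bound[OF elim, of r s t T] bound[OF elim, of r t s T]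
        by (cases "s \<le> t") (auto simp: dist_commute abs_minus_commute)
    qed
  qed
  then show ?thesis using that c(1) by blast
qed

end

section \<open>The limit limit_semigroup\<close>

locale convergent_stable_family = stable_family I x0 \<alpha> \<omega>
  for I :: "real \<Rightarrow> 'a::complete_space \<Rightarrow> 'a" and x0 \<alpha> \<omega> +
  fixes D :: "'a set" and N :: "nat \<Rightarrow> nat"
  assumes D_lip: "D \<subseteq> lipschitz_set I"
    and D_dense: "closure D = UNIV"
    and N_mono: "strict_mono N"
    and conv_dyadic: "\<lbrakk>x \<in> D; t \<in> dyadic\<rbrakk> \<Longrightarrow> convergent (\<lambda>l. iter I (N l) t x)"
begin

definition limit_semigroup :: "real \<Rightarrow> 'a \<Rightarrow> 'a" where
  "limit_semigroup t x = lim (\<lambda>l. iter I (N l) t x)"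

lemma eventually_N: "eventually P sequentially \<Longrightarrow> \<forall>\<^sub>F l in sequentially. P (N l)"
  using filterlim_subseq[OF N_mono] by (simp add: filterlim_iff)

lemma mesh_tendsto_0: "(\<lambda>l. C * (1 / 2 ^ N l) :: real) \<longlonglongrightarrow> 0"
proof -
  have "(\<lambda>n. (1/2) ^ n :: real) \<longlonglongrightarrow> 0" by (intro LIMSEQ_realpow_zero) auto
  then have "(\<lambda>l. (1/2) ^ N l :: real) \<longlonglongrightarrow> 0"
    using LIMSEQ_subseq_LIMSEQ[OF _ N_mono] by (fastforce simp: o_def)
  then show ?thesis using tendsto_mult_right_zero by (force simp: power_divide)
qed

lemma dense_approx:
  assumes "e > 0"
  obtains y where "y \<in> D" "dist x y < e"
  using assms D_dense closure_approachable[of x D] by (auto simp: dist_commute)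

lemma in_cball_add_one: "dist x y < 1 \<Longrightarrow> y \<in> cball x0 (dist x0 x + 1)"
  using dist_triangle[of x0 y x] by auto

lemma convergent_iter_dense:
  assumes x: "x \<in> D" and t: "t \<ge> 0"
  shows "convergent (\<lambda>l. iter I (N l) t x)"
proof (rule convergent_if_approximable)
  fix e :: real assume e: "e > 0"
  define r where "r = dist x0 x"
  have r: "r \<ge> 0" "x \<in> cball x0 r" by (auto simp: r_def)
  obtain c where c: "c \<ge> 0" and ev: "\<forall>\<^sub>F n in sequentially. drift_bound c x n"
    using iter_time_lipschitz x D_lip by blast
  define C where "C = c * growth r t"
  have C: "C \<ge> 0" by (simp add: C_def c)
  obtain q where q: "q \<in> dyadic" "0 \<le> q" "q \<le> t" "\<bar>q - t\<bar> < e / 2 / (C + 1)"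
    using dyadic_approx_below[OF t, of "e / 2 / (C + 1)"] e C by auto
  have "C * \<bar>q - t\<bar> \<le> (C + 1) * \<bar>q - t\<bar>" by (simp add: mult_right_mono)
  also have "\<dots> < e / 2" using q(4) C by (simp add: field_simps)
  finally have Cq: "C * \<bar>q - t\<bar> < e / 2" .
  have small: "\<forall>\<^sub>F l in sequentially. C * (1 / 2 ^ N l) < e / 2"
    using e by (intro order_tendstoD(2)[OF mesh_tendsto_0]) auto
  have "\<forall>\<^sub>F l in sequentially. dist (iter I (N l) t x) (iter I (N l) q x) < e"
    using small eventually_N[OF ev]
  proof eventually_elim
    case (elim l)
    have "dist (iter I (N l) q x) (iter I (N l) t x) \<le> C * (\<bar>q - t\<bar> + 1 / 2 ^ N l)"
      unfolding C_def using drift_boundD[OF elim(2) r, of q t t] q t by simp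
    also have "\<dots> < e" using elim(1) Cq unfolding distrib_left by linarith
    finally show ?case by (simp add: dist_commute)
  qed
  then show "\<exists>v. convergent v \<and> (\<forall>\<^sub>F l in sequentially. dist (iter I (N l) t x) (v l) < e)"
    using conv_dyadic[OF x q(1)] by blast
qed

lemma convergent_iter:
  assumes t: "t \<ge> 0"
  shows "convergent (\<lambda>l. iter I (N l) t x)"
proof (rule convergent_if_approximable)
  fix e :: real assume e: "e > 0"
  define r where "r = dist x0 x + 1"
  define L where "L = growth r t"
  have L: "L > 0" by (simp add: L_def)
  obtain y where y: "y \<in> D" "dist x y < min 1 (e / L)"
    using dense_approx[of "min 1 (e / L)"] e L by auto
  have "r \<ge> 0" "x \<in> cball x0 r" "y \<in> cball x0 r"
    using y in_cball_add_one[of x y] by (auto simp: r_def)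
  then have "dist (iter I (N l) t x) (iter I (N l) t y) \<le> L * dist x y" for l
    unfolding L_def using t by (intro iter_lipschitz) auto
  moreover have "L * dist x y < e" using y L by (simp add: field_simps)
  ultimately have "dist (iter I (N l) t x) (iter I (N l) t y) < e" for l
    by (meson le_less_trans)
  then show "\<exists>v. convergent v \<and> (\<forall>\<^sub>F l in sequentially. dist (iter I (N l) t x) (v l) < e)"
    using convergent_iter_dense[OF y(1) t] by (intro exI conjI always_eventually allI)
qed

lemma tendsto_limit_semigroup: "t \<ge> 0 \<Longrightarrow> (\<lambda>l. iter I (N l) t x) \<longlonglongrightarrow> limit_semigroup t x"
  unfolding limit_semigroup_def using convergent_iter convergent_LIMSEQ_iff by blast

lemma limit_semigroup_zero: "limit_semigroup 0 = id"
  by (rule ext) (simp add: limit_semigroup_def iter_def)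

lemma limit_semigroup_in_ball:
  assumes "r \<ge> 0" "t \<ge> 0" "x \<in> cball x0 r"
  shows "limit_semigroup t x \<in> cball x0 (\<alpha> r t)"
  using closed_sequentially[OF closed_cball _ tendsto_limit_semigroup] iter_in_ball assms by blast

lemma limit_semigroup_lipschitz:
  assumes "r \<ge> 0" "t \<ge> 0" "x \<in> cball x0 r" "y \<in> cball x0 r"
  shows "dist (limit_semigroup t x) (limit_semigroup t y) \<le> growth r t * dist x y"
proof (rule tendsto_upperbound)
  show "(\<lambda>l. dist (iter I (N l) t x) (iter I (N l) t y)) \<longlonglongrightarrow> dist (limit_semigroup t x) (limit_semigroup t y)"
    using assms by (intro tendsto_dist tendsto_limit_semigroup)
  show "\<forall>\<^sub>F l in sequentially. dist (iter I (N l) t x) (iter I (N l) t y) \<le> growth r t * dist x y"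
    using assms iter_lipschitz by (intro always_eventually) blast
qed simp

lemma limit_semigroup_time_lipschitz:
  assumes x: "x \<in> lipschitz_set I"
  obtains c where "c \<ge> 0" "\<And>r T s t. \<lbrakk>r \<ge> 0; x \<in> cball x0 r; s \<in> {0..T}; t \<in> {0..T}\<rbrakk> \<Longrightarrow>
    dist (limit_semigroup s x) (limit_semigroup t x) \<le> c * growth r T * \<bar>s - t\<bar>"
proof -
  obtain c where c: "c \<ge> 0" and ev: "\<forall>\<^sub>F n in sequentially. drift_bound c x n"
    using iter_time_lipschitz x by blast
  have "dist (limit_semigroup s x) (limit_semigroup t x) \<le> c * growth r T * \<bar>s - t\<bar>"
    if "r \<ge> 0" "x \<in> cball x0 r" "s \<in> {0..T}" "t \<in> {0..T}" for r T s t
  proof (rule tendsto_le)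
    show "(\<lambda>l. dist (iter I (N l) s x) (iter I (N l) t x)) \<longlonglongrightarrow> dist (limit_semigroup s x) (limit_semigroup t x)"
      using that by (intro tendsto_dist tendsto_limit_semigroup) auto
    have "(\<lambda>l. c * growth r T * (\<bar>s - t\<bar> + 1 * (1 / 2 ^ N l))) \<longlonglongrightarrow> c * growth r T * (\<bar>s - t\<bar> + 0)"
      by (intro tendsto_intros mesh_tendsto_0)
    then show "(\<lambda>l. c * growth r T * (\<bar>s - t\<bar> + 1 / 2 ^ N l)) \<longlonglongrightarrow> c * growth r T * \<bar>s - t\<bar>"
      by simp
    show "\<forall>\<^sub>F l in sequentially. dist (iter I (N l) s x) (iter I (N l) t x)
        \<le> c * growth r T * (\<bar>s - t\<bar> + 1 / 2 ^ N l)"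
      using eventually_N[OF ev] by eventually_elim (use that drift_boundD in blast)
  qed simp
  then show ?thesis using that c by blast
qed

text \<open>The iterates at a fixed time are equi-Lipschitz near \<open>w\<close>, so their pointwise convergence is
  continuous convergence. This makes the composition of two iterates converge to the composition
  of the limits.\<close>

lemma tendsto_limit_semigroup_moving:
  assumes s: "s \<ge> 0" and z: "(\<lambda>l. z l) \<longlonglongrightarrow> w"
  shows "(\<lambda>l. iter I (N l) s (z l)) \<longlonglongrightarrow> limit_semigroup s w"
proof -
  define r where "r = dist x0 w + 1"
  have r: "r \<ge> 0" "w \<in> cball x0 r" by (auto simp: r_def)
  have "\<forall>\<^sub>F l in sequentially. dist (z l) w < 1"
    using tendstoD[OF z, of 1] by simp
  then have "\<forall>\<^sub>F l in sequentially. dist (iter I (N l) s (z l)) (limit_semigroup s w)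
      \<le> growth r s * dist (z l) w + dist (iter I (N l) s w) (limit_semigroup s w)"
  proof eventually_elim
    case (elim l)
    then have "z l \<in> cball x0 r" using in_cball_add_one[of w "z l"] by (simp add: r_def dist_commute)
    then show ?case
      using iter_lipschitz[OF r(1) s _ r(2), of "z l" "N l"]
        dist_triangle[of "iter I (N l) s (z l)" "limit_semigroup s w" "iter I (N l) s w"] by simp
  qed
  moreover have "(\<lambda>l. growth r s * dist (z l) w + dist (iter I (N l) s w) (limit_semigroup s w)) \<longlonglongrightarrow> 0"
  proof (rule tendsto_add_zero)
    have "(\<lambda>l. dist (z l) w) \<longlonglongrightarrow> 0" using z by (rule iffD1[OF tendsto_dist_iff])
    then show "(\<lambda>l. growth r s * dist (z l) w) \<longlonglongrightarrow> 0" by (rule tendsto_mult_right_zero)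
    show "(\<lambda>l. dist (iter I (N l) s w) (limit_semigroup s w)) \<longlonglongrightarrow> 0"
      using tendsto_limit_semigroup[OF s] by (rule iffD1[OF tendsto_dist_iff])
  qed
  ultimately have "(\<lambda>l. dist (iter I (N l) s (z l)) (limit_semigroup s w)) \<longlonglongrightarrow> 0"
    by (rule tendsto_sandwich[OF _ _ tendsto_const, rotated]) simp
  then show ?thesis by (rule iffD2[OF tendsto_dist_iff])
qed

lemma isCont_limit_semigroup:
  assumes t: "t \<ge> 0"
  shows "isCont (limit_semigroup t) x"
proof -
  define r where "r = dist x0 x + 1"
  have "(growth r t)-lipschitz_on (cball x0 r) (limit_semigroup t)"
    using limit_semigroup_lipschitz t by (intro lipschitz_onI) (auto simp: r_def)
  then have "continuous_on (ball x0 r) (limit_semigroup t)"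
    by (meson ball_subset_cball continuous_on_subset lipschitz_on_continuous_on)
  moreover have "x \<in> ball x0 r" by (simp add: r_def)
  ultimately show ?thesis by (simp add: continuous_on_eq_continuous_at)
qed

text \<open>The iterates at times \<open>s\<close> and \<open>t\<close> compose to an exact iterate at a grid time, which differs
  from \<open>s + t\<close> by less than the two mesh widths lost in rounding \<open>s\<close> and \<open>t\<close>; the third mesh width
  comes from rounding \<open>s + t\<close>.\<close>

lemma limit_semigroup_add_dense:
  assumes x: "x \<in> D" and st: "s \<ge> 0" "t \<ge> 0"
  shows "limit_semigroup (s + t) x = limit_semigroup s (limit_semigroup t x)"
proof -
  define r where "r = dist x0 x"
  have r: "r \<ge> 0" "x \<in> cball x0 r" by (auto simp: r_def)
  obtain c where c: "c \<ge> 0" and ev: "\<forall>\<^sub>F n in sequentially. drift_bound c x n"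
    using iter_time_lipschitz x D_lip by blast
  define C where "C = c * growth r (s + t)"
  have C: "C \<ge> 0" by (simp add: C_def c)
  have "\<forall>\<^sub>F l in sequentially. dist (iter I (N l) (s + t) x) (iter I (N l) s (iter I (N l) t x))
      \<le> C * 3 * (1 / 2 ^ N l)"
    using eventually_N[OF ev]
  proof eventually_elim
    case (elim l)
    define n where "n = N l"
    define h :: real where "h = 1 / 2 ^ n"
    define k where "k = nat \<lfloor>2 ^ n * s\<rfloor>"
    define m where "m = nat \<lfloor>2 ^ n * t\<rfloor>"
    \<comment> \<open>the grid time at which the composition of the two iterates ends\<close>
    define u where "u = real (k + m) / 2 ^ n"
    have u: "0 \<le> u" "u \<le> s + t" "\<bar>s + t - u\<bar> \<le> 2 * h"
      using grid_point[OF st(1), of n] grid_point[OF st(2), of n]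
      by (auto simp: u_def k_def m_def h_def add_divide_distrib)
    have "iter I n s (iter I n t x) = iter I n u x"
      unfolding u_def iter_grid by (simp add: iter_def k_def m_def funpow_add)
    moreover have "dist (iter I n (s + t) x) (iter I n u x) \<le> C * (\<bar>s + t - u\<bar> + h)"
      using drift_boundD[OF elim r, of "s + t" "s + t" u] u st by (simp add: C_def n_def h_def)
    moreover have "C * (\<bar>s + t - u\<bar> + h) \<le> C * (3 * h)"
      using u C by (intro mult_left_mono) auto
    ultimately show ?case by (simp add: n_def h_def)
  qed
  then have "(\<lambda>l. dist (iter I (N l) (s + t) x) (iter I (N l) s (iter I (N l) t x))) \<longlonglongrightarrow> 0"
    by (intro tendsto_sandwich[OF _ _ tendsto_const mesh_tendsto_0[of "C * 3"]]) auto
  moreover have "(\<lambda>l. dist (iter I (N l) (s + t) x) (iter I (N l) s (iter I (N l) t x)))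
      \<longlonglongrightarrow> dist (limit_semigroup (s + t) x) (limit_semigroup s (limit_semigroup t x))"
    using st by (intro tendsto_dist tendsto_limit_semigroup tendsto_limit_semigroup_moving) auto
  ultimately have "0 = dist (limit_semigroup (s + t) x) (limit_semigroup s (limit_semigroup t x))"
    by (rule LIMSEQ_unique)
  then show ?thesis by simp
qed

lemma limit_semigroup_add:
  assumes st: "s \<ge> 0" "t \<ge> 0"
  shows "limit_semigroup (s + t) = limit_semigroup s \<circ> limit_semigroup t"
proof
  fix x
  have "x \<in> closure D" using D_dense by simp
  then obtain z where z: "\<And>l. z l \<in> D" "z \<longlonglongrightarrow> x" by (auto simp: closure_sequential)
  have "(\<lambda>l. limit_semigroup (s + t) (z l)) \<longlonglongrightarrow> limit_semigroup (s + t) x"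
    using st by (intro isCont_tendsto_compose[OF isCont_limit_semigroup z(2)]) simp
  moreover have "(\<lambda>l. limit_semigroup s (limit_semigroup t (z l))) \<longlonglongrightarrow> limit_semigroup s (limit_semigroup t x)"
    using st z(2) by (intro isCont_tendsto_compose[OF isCont_limit_semigroup]) auto
  ultimately have "limit_semigroup (s + t) x = limit_semigroup s (limit_semigroup t x)"
    unfolding limit_semigroup_add_dense[OF z(1) st] by (rule LIMSEQ_unique)
  then show "limit_semigroup (s + t) x = (limit_semigroup s \<circ> limit_semigroup t) x" by simp
qed

text \<open>The orbit of a point of \<open>D\<close> is Lipschitz on bounded time intervals, and every orbit is a
  locally uniform limit of such orbits.\<close>

lemma continuous_on_limit_semigroup: "continuous_on {0..} (\<lambda>t. limit_semigroup t x)"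
  unfolding continuous_on_iff
proof (intro ballI allI impI)
  fix t e :: real assume t: "t \<in> {0..}" and e: "e > 0"
  define T where "T = t + 1"
  define r where "r = dist x0 x + 1"
  define L where "L = growth r T"
  have L: "L > 0" by (simp add: L_def)
  obtain y where y: "y \<in> D" "dist x y < min 1 (e / 3 / L)"
    using dense_approx[of "min 1 (e / 3 / L)"] e L by auto
  have r: "r \<ge> 0" "x \<in> cball x0 r" "y \<in> cball x0 r"
    using y in_cball_add_one[of x y] by (auto simp: r_def)
  obtain c where c: "c \<ge> 0" "\<And>r T s t. \<lbrakk>r \<ge> 0; y \<in> cball x0 r; s \<in> {0..T}; t \<in> {0..T}\<rbrakk> \<Longrightarrow>
    dist (limit_semigroup s y) (limit_semigroup t y) \<le> c * growth r T * \<bar>s - t\<bar>"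
    using limit_semigroup_time_lipschitz y(1) D_lip by blast
  have near: "dist (limit_semigroup s x) (limit_semigroup s y) < e / 3" if "s \<in> {0..T}" for s
  proof -
    have "dist (limit_semigroup s x) (limit_semigroup s y) \<le> growth r s * dist x y"
      using limit_semigroup_lipschitz r that by simp
    also have "\<dots> \<le> L * dist x y"
      unfolding L_def using that r by (intro mult_right_mono growth_mono) auto
    also have "\<dots> < e / 3" using y L by (simp add: field_simps)
    finally show ?thesis .
  qed
  define C where "C = c * L"
  have C: "C \<ge> 0" using c L by (simp add: C_def)
  define d where "d = min 1 (e / 3 / (C + 1))"
  have "d > 0" using e C by (simp add: d_def)
  moreover have "dist (limit_semigroup s x) (limit_semigroup t x) < e" if "s \<in> {0..}" "dist s t < d" for s
  proof -
    have sT: "s \<in> {0..T}" "t \<in> {0..T}" using that t by (auto simp: T_def d_def dist_real_def)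
    have "dist (limit_semigroup s y) (limit_semigroup t y) \<le> C * \<bar>s - t\<bar>"
      unfolding C_def L_def using c(2) r sT by simp
    also have "\<dots> \<le> (C + 1) * \<bar>s - t\<bar>" by (simp add: mult_right_mono)
    also have "\<dots> < e / 3" using that C by (simp add: d_def dist_real_def field_simps)
    finally have "dist (limit_semigroup s y) (limit_semigroup t y) < e / 3" .
    then show ?thesis
      using near[OF sT(1)] near[OF sT(2)] dist_commute[of "limit_semigroup t x" "limit_semigroup t y"]
        dist_triangle[of "limit_semigroup s x" "limit_semigroup t x" "limit_semigroup s y"]
        dist_triangle[of "limit_semigroup s y" "limit_semigroup t x" "limit_semigroup t y"] by linarith
  qed
  ultimately show "\<exists>d>0. \<forall>s\<in>{0..}. dist s t < d \<longrightarrow> dist (limit_semigroup s x) (limit_semigroup t x) < e"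
    by blast
qed

end

section \<open>Existence of the limit_semigroup\<close>

theorem theorem2p5:
  fixes I :: "real \<Rightarrow> 'a::complete_space \<Rightarrow> 'a"
    and x0 :: 'a
    and \<alpha> :: "real \<Rightarrow> real \<Rightarrow> real"
    and \<omega> :: "real \<Rightarrow> real"
  assumes A1: "I 0 = id"
    and A2_nonneg: "\<forall>r\<ge>0. \<forall>t\<ge>0. \<alpha> r t \<ge> 0"
    and A2_mono: "\<forall>r\<ge>0. mono_on {0..} (\<alpha> r)"
    and A2_comp: "\<forall>r\<ge>0. \<forall>s\<ge>0. \<forall>t\<ge>0. \<alpha> (\<alpha> r s) t \<le> \<alpha> r (s + t)"
    and A2_ball: "\<forall>r\<ge>0. \<forall>t\<ge>0. I t ` cball x0 r \<subseteq> cball x0 (\<alpha> r t)"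
    and A3_nonneg: "\<forall>r\<ge>0. \<omega> r \<ge> 0"
    and A3_mono: "mono_on {0..} \<omega>"
    and A3_lip: "\<forall>r\<ge>0. \<forall>t\<in>{0..1}. \<forall>x\<in>cball x0 r. \<forall>y\<in>cball x0 r.
                   dist (I t x) (I t y) \<le> exp (t * \<omega> r) * dist x y"
    and A4: "\<exists>D. countable D \<and> D \<subseteq> lipschitz_set I \<and> closure D = UNIV \<and>
               (\<forall>x\<in>D. \<forall>t\<in>dyadic.
                  compact (closure {iter I n t x | n. n \<ge> 1 \<and> 2 ^ n * t \<in> \<nat>}))"
  shows "\<exists>S :: real \<Rightarrow> 'a \<Rightarrow> 'a.
      (\<exists>N :: nat \<Rightarrow> nat. strict_mono N \<and> (\<forall>l. N l \<ge> 1) \<and>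
         (\<forall>x. \<forall>t\<in>dyadic. (\<lambda>l. iter I (N l) t x) \<longlonglongrightarrow> S t x)) \<and>
      (S 0 = id \<and> (\<forall>s\<ge>0. \<forall>t\<ge>0. S (s + t) = S s \<circ> S t)) \<and>
      (\<forall>r\<ge>0. \<forall>t\<ge>0.
         (\<forall>x\<in>cball x0 r. dist x0 (S t x) \<le> \<alpha> r t) \<and>
         (\<forall>x\<in>cball x0 r. \<forall>y\<in>cball x0 r.
            dist (S t x) (S t y) \<le> exp (t * \<omega> (\<alpha> r t)) * dist x y)) \<and>
      (\<forall>x. continuous_on {0..} (\<lambda>t. S t x)) \<and>
      (\<forall>r\<ge>0. \<forall>x\<in>cball x0 r \<inter> lipschitz_set I. \<exists>c\<ge>0. \<forall>T\<ge>0. \<forall>s\<in>{0..T}. \<forall>t\<in>{0..T}.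
         dist (S s x) (S t x) \<le> c * exp (T * \<omega> (\<alpha> r T)) * \<bar>s - t\<bar>)"
proof -
  interpret stable_family I x0 \<alpha> \<omega>
  proof
    show "I t x \<in> cball x0 (\<alpha> r t)" if "r \<ge> 0" "t \<ge> 0" "x \<in> cball x0 r" for r t x
      using A2_ball that by blast
    show "dist (I t x) (I t y) \<le> exp (t * \<omega> r) * dist x y"
      if "r \<ge> 0" "0 \<le> t" "t \<le> 1" "x \<in> cball x0 r" "y \<in> cball x0 r" for r t x y
      using A3_lip that by simp
  qed (use A1 A2_nonneg A2_mono A2_comp A3_nonneg A3_mono in \<open>auto simp: mono_on_def\<close>)
  obtain D where D: "countable D" "D \<subseteq> lipschitz_set I" "closure D = UNIV"
    and cpt: "\<And>x t. x \<in> D \<Longrightarrow> t \<in> dyadic \<Longrightarrow>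
      compact (closure {iter I n t x | n. n \<ge> 1 \<and> 2 ^ n * t \<in> \<nat>})"
    using A4 by blast
  have "\<exists>C. compact C \<and> (\<forall>\<^sub>F n in sequentially. iter I n (snd p) (fst p) \<in> C)"
    if pJ: "p \<in> D \<times> dyadic" for p
  proof -
    obtain x t where p: "p = (x, t)" "x \<in> D" "t \<in> dyadic" using pJ by auto
    let ?A = "{iter I n t x | n. n \<ge> 1 \<and> 2 ^ n * t \<in> \<nat>}"
    have "\<forall>\<^sub>F n in sequentially. iter I n t x \<in> closure ?A"
      using dyadic_multiple_Nats[OF p(3)] eventually_ge_at_top[of 1]
      by eventually_elim (rule subsetD[OF closure_subset], blast)
    then show ?thesis using cpt[OF p(2,3)] by (auto simp: p(1))
  qed
  then obtain N where N: "strict_mono N" "\<And>l. N l \<ge> 1"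
    and conv: "\<And>p. p \<in> D \<times> dyadic \<Longrightarrow> convergent (\<lambda>l. iter I (N l) (snd p) (fst p))"
    using diagonal_subsequence_convergent
      [OF countable_SIGMA[OF D(1) countable_dyadic], of "\<lambda>p n. iter I n (snd p) (fst p)"]
    by blast
  interpret convergent_stable_family I x0 \<alpha> \<omega> D N
  proof unfold_locales
    show "convergent (\<lambda>l. iter I (N l) t x)" if "x \<in> D" "t \<in> dyadic" for x t
      using conv[of "(x, t)"] that by simp
  qed (use D N in auto)
  have nonneg: "t \<ge> 0" if "t \<in> dyadic" for t using that by (auto simp: dyadic_def)
  show ?thesis
  proof (intro exI[of _ limit_semigroup] conjI allI impI ballI)
    show "\<exists>N. strict_mono N \<and> (\<forall>l. N l \<ge> 1) \<and>
        (\<forall>x. \<forall>t\<in>dyadic. (\<lambda>l. iter I (N l) t x) \<longlonglongrightarrow> limit_semigroup t x)"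
      using N tendsto_limit_semigroup nonneg by blast
    fix r :: real and x assume "r \<ge> 0" "x \<in> cball x0 r \<inter> lipschitz_set I"
    then show "\<exists>c\<ge>0. \<forall>T\<ge>0. \<forall>s\<in>{0..T}. \<forall>t\<in>{0..T}.
        dist (limit_semigroup s x) (limit_semigroup t x) \<le> c * growth r T * \<bar>s - t\<bar>"
      by (elim IntE) (rule limit_semigroup_time_lipschitz[of x], blast+)
  next
    show "dist x0 (limit_semigroup t x) \<le> \<alpha> r t" if "r \<ge> 0" "t \<ge> 0" "x \<in> cball x0 r" for r t x
      using limit_semigroup_in_ball[OF that] by simp
  qed (use limit_semigroup_zero limit_semigroup_add limit_semigroup_lipschitz continuous_on_limit_semigroup in auto)
qed

end
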